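(* Let $(\Gamma,\mathbf{q})$ be a polarized metrized graph of genus $\bar g$ with an adequate vertex set $V(\Gamma)$. Let $\mathrm{L}=(l_{pq})_{p,q\in V(\Gamma)}$ be the discrete Laplacian matrix of $\Gamma$ with respect to $V(\Gamma)$, and let $\mathrm{L}^+=(l^+_{pq})_{p,q\in V(\Gamma)}$ be its Moore–Penrose pseudo inverse. Then $$\theta(\Gamma)=2(2\bar g-2)\sum_{p\in V(\Gamma)}\big(\upsilon(p)-2+2\mathbf{q}(p)\big)\,l^+_{pp}\;-\;2\sum_{p,\,q\in V(\Gamma)}\big(\upsilon(p)+2\mathbf{q}(p)\big)\big(\upsilon(q)+2\mathbf{q}(q)\big)\,l^+_{pq}.$$
   Context: Metrized graph: a finite connected graph $\Gamma$ in which each edge $e_i$ is identified with a closed line segment of length $L_i>0$; multiple edges and self-loops are allowed. The valence $\upsilon(p)$ of $p\in\Gamma$ is the number of directions emanating from $p$. A vertex set $V(\Gamma)$ is a finite non-empty subset of $\Gamma$ containing all points with $\upsilon(p)\neq 2$; it may be enlarged by adding valence-2 points. Given $V(\Gamma)$, $E(\Gamma)$ is the corresponding set of edges, $e=|E(\Gamma)|$, $v=|V(\Gamma)|$, and $g(\Gamma)=e-v+1$. Adequate vertex set: $V(\Gamma)$ is adequate if, with respect to it, $\Gamma$ has no self-loops and no multiple edges joining two vertices. Resistance function: $r(x,y)$ is the effective resistance between $x,y\in\Gamma$ when $\Gamma$ is regarded as a resistive electric circuit in which the resistance of each edge is its length. Polarized metrized graph (pm-graph): a pair $(\Gamma,\mathbf{q})$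 where $\mathbf{q}:\Gamma\to\mathbb{N}=\{0,1,2,\dots\}$ is supported on the vertex set $V(\Gamma)$ (in particular $\mathbf q=0$ at any valence-2 points added to the vertex set to make it adequate), such that the canonical divisor $K=\sum_{p\in V(\Gamma)}(\upsilon(p)-2+2\mathbf{q}(p))\,p$ is effective, i.e. all its coefficients are $\ge 0$. Its genus is $\bar g=1+\frac12\deg K=g(\Gamma)+\sum_{p\in V(\Gamma)}\mathbf{q}(p)$. Invariant $\theta$: $\theta(\Gamma)=\sum_{p,\,q\in V(\Gamma)}(\upsilon(p)-2+2\mathbf{q}(p))(\upsilon(q)-2+2\mathbf{q}(q))\,r(p,q)$, the sum being over all ordered pairs. Discrete Laplacian (for an adequate vertex set): $\mathrm{L}=(l_{pq})$ is the $v\times v$ matrix with $l_{pq}=0$ if $p\ne q$ are not adjacent, $l_{pq}=-1/L_k$ if $p\neq q$ are joined by an edge of length $L_k$, and $l_{pp}=-\sum_{s\in V(\Gamma)\setminus\{p\}}l_{ps}$. *)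

theory Defs
  imports "HOL-Analysis.Analysis"
begin

section \<open>Metrized graphs\<close>

text \<open>
  A metrized graph \<open>\<Gamma>\<close> together with a chosen vertex set \<open>V(\<Gamma>)\<close> is presented by its edges with
  respect to \<open>V(\<Gamma>)\<close>. The vertices are the elements of a finite type \<open>'v\<close>; each edge \<open>e\<close> is a closed
  segment \<open>[0, len e]\<close> glued at \<open>0\<close> to \<open>tail e\<close> and at \<open>len e\<close> to \<open>head e\<close>. The orientation only serves
  to parametrize the edge. Self-loops, multiple edges and vertices of valence 2 are allowed.
\<close>

record ('v, 'e) mgraph =
  edges :: "'e set"
  tail :: "'e \<Rightarrow> 'v"
  head :: "'e \<Rightarrow> 'v"
  len :: "'e \<Rightarrow> real"

definition metrized_graph :: "('v::finite, 'e) mgraph \<Rightarrow> bool" where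
  "metrized_graph \<Gamma> \<longleftrightarrow>
     finite (edges \<Gamma>) \<and>
     (\<forall>e\<in>edges \<Gamma>. len \<Gamma> e > 0) \<and>
     (\<forall>p q. (p, q) \<in> ({(tail \<Gamma> e, head \<Gamma> e) | e. e \<in> edges \<Gamma>} \<union>
                      {(head \<Gamma> e, tail \<Gamma> e) | e. e \<in> edges \<Gamma>})\<^sup>*)"

text \<open>
  \<open>Inner e t\<close> is the point of the open edge \<open>e\<close> at distance \<open>t\<close> from \<open>tail e\<close> along \<open>e\<close>.
\<close>

datatype ('v, 'e) point = Node 'v | Inner 'e real

definition vertex_set :: "('v::finite, 'e) mgraph \<Rightarrow> ('v, 'e) point set" where
  "vertex_set \<Gamma> = range Node"

definition points :: "('v::finite, 'e) mgraph \<Rightarrow> ('v, 'e) point set" where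
  "points \<Gamma> = vertex_set \<Gamma> \<union> {Inner e t | e t. e \<in> edges \<Gamma> \<and> 0 < t \<and> t < len \<Gamma> e}"

definition along :: "('v::finite, 'e) mgraph \<Rightarrow> 'e \<Rightarrow> real \<Rightarrow> ('v, 'e) point" where
  "along \<Gamma> e t =
     (if t = 0 then Node (tail \<Gamma> e) else if t = len \<Gamma> e then Node (head \<Gamma> e) else Inner e t)"

text \<open>
  The direction \<open>(e, True)\<close> runs along \<open>e\<close> towards its head, \<open>(e, False)\<close> towards its tail. A self-loop
  at \<open>p\<close> therefore contributes two directions at \<open>p\<close>.
\<close>

fun directions :: "('v::finite, 'e) mgraph \<Rightarrow> ('v, 'e) point \<Rightarrow> ('e \<times> bool) set" where
  "directions \<Gamma> (Node p) =
     {(e, True) | e. e \<in> edges \<Gamma> \<and> tail \<Gamma> e = p} \<union> {(e, False) | e. e \<in> edges \<Gamma> \<and> head \<Gamma> e = p}"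
| "directions \<Gamma> (Inner e t) = {(e, True), (e, False)}"

definition valence :: "('v::finite, 'e) mgraph \<Rightarrow> ('v, 'e) point \<Rightarrow> nat" where
  "valence \<Gamma> x = card (directions \<Gamma> x)"

text \<open>
  The point at (small) distance \<open>s\<close> from \<open>x\<close> in a direction at \<open>x\<close>.
\<close>

fun move :: "('v::finite, 'e) mgraph \<Rightarrow> ('v, 'e) point \<Rightarrow> 'e \<times> bool \<Rightarrow> real \<Rightarrow> ('v, 'e) point" where
  "move \<Gamma> (Node p) (e, b) s = (if b then along \<Gamma> e s else along \<Gamma> e (len \<Gamma> e - s))"
| "move \<Gamma> (Inner e' t) (e, b) s = (if b then along \<Gamma> e (t + s) else along \<Gamma> e (t - s))"

text \<open>
  Adequacy of the vertex set: no self-loops and no multiple edges.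
\<close>

definition adequate :: "('v::finite, 'e) mgraph \<Rightarrow> bool" where
  "adequate \<Gamma> \<longleftrightarrow>
     (\<forall>e\<in>edges \<Gamma>. tail \<Gamma> e \<noteq> head \<Gamma> e) \<and>
     (\<forall>e\<in>edges \<Gamma>. \<forall>e'\<in>edges \<Gamma>. {tail \<Gamma> e, head \<Gamma> e} = {tail \<Gamma> e', head \<Gamma> e'} \<longrightarrow> e = e')"

section \<open>Effective resistance\<close>

text \<open>
  \<open>\<Gamma>\<close> is a circuit of resistive wire, a piece of length \<open>l\<close> having resistance \<open>l\<close>. The function \<open>f\<close>
  is an electric potential when a unit current enters at \<open>x\<close> and leaves at \<open>y\<close>:
  by Ohm's law, every segment with neither \<open>x\<close> nor \<open>y\<close> in its interior carries a constant current \<open>c\<close>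
  (from \<open>s\<close> to \<open>t\<close> for \<open>s < t\<close>) and the potential drop equals \<open>c\<close> times the length; by Kirchhoff's law,
  the net current flowing out of a point along the edges is the current fed in there.
\<close>

definition outflow ::
  "('v::finite, 'e) mgraph \<Rightarrow> (('v, 'e) point \<Rightarrow> real) \<Rightarrow> ('v, 'e) point \<Rightarrow> 'e \<times> bool \<Rightarrow> real" where
  "outflow \<Gamma> f z d = Lim (at_right 0) (\<lambda>s. (f z - f (move \<Gamma> z d s)) / s)"

definition circuit_potential ::
  "('v::finite, 'e) mgraph \<Rightarrow> ('v, 'e) point \<Rightarrow> ('v, 'e) point \<Rightarrow> (('v, 'e) point \<Rightarrow> real) \<Rightarrow> bool"
  where
  "circuit_potential \<Gamma> x y f \<longleftrightarrow>
     (\<forall>e\<in>edges \<Gamma>. \<forall>a b. 0 \<le> a \<and> a < b \<and> b \<le> len \<Gamma> e \<and> (\<forall>t\<in>{a<..<b}. along \<Gamma> e t \<notin> {x, y}) \<longrightarrow>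
        (\<exists>c. \<forall>s\<in>{a..b}. \<forall>t\<in>{a..b}. f (along \<Gamma> e s) - f (along \<Gamma> e t) = c * (t - s))) \<and>
     (\<forall>z\<in>points \<Gamma>. (\<Sum>d\<in>directions \<Gamma> z. outflow \<Gamma> f z d) =
        (if z = x then 1 else 0) - (if z = y then 1 else 0))"

text \<open>
  The effective resistance is the potential drop for a unit current.
\<close>

definition resistance ::
  "('v::finite, 'e) mgraph \<Rightarrow> ('v, 'e) point \<Rightarrow> ('v, 'e) point \<Rightarrow> real" where
  "resistance \<Gamma> x y = (THE r. \<exists>f. circuit_potential \<Gamma> x y f \<and> r = f x - f y)"

section \<open>Polarizations\<close>

definition canonical_coeff ::
  "('v::finite, 'e) mgraph \<Rightarrow> (('v, 'e) point \<Rightarrow> nat) \<Rightarrow> ('v, 'e) point \<Rightarrow> int" where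
  "canonical_coeff \<Gamma> Q x = int (valence \<Gamma> x) - 2 + 2 * int (Q x)"

definition pm_graph :: "('v::finite, 'e) mgraph \<Rightarrow> (('v, 'e) point \<Rightarrow> nat) \<Rightarrow> bool" where
  "pm_graph \<Gamma> Q \<longleftrightarrow>
     metrized_graph \<Gamma> \<and>
     (\<forall>x \<in> points \<Gamma> - vertex_set \<Gamma>. Q x = 0) \<and>
     (\<forall>x \<in> vertex_set \<Gamma>. canonical_coeff \<Gamma> Q x \<ge> 0)"

definition pm_genus :: "('v::finite, 'e) mgraph \<Rightarrow> (('v, 'e) point \<Rightarrow> nat) \<Rightarrow> real" where
  "pm_genus \<Gamma> Q = 1 + real_of_int (\<Sum>x\<in>vertex_set \<Gamma>. canonical_coeff \<Gamma> Q x) / 2"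

lemma pm_genus_eq:
  fixes \<Gamma> :: "('v::finite, 'e) mgraph"
  assumes "metrized_graph \<Gamma>"
  shows "pm_genus \<Gamma> Q =
    (real (card (edges \<Gamma>)) - real CARD('v) + 1) + (\<Sum>x\<in>vertex_set \<Gamma>. real (Q x))"
proof -
  have fin: "finite (edges \<Gamma>)" using assms by (simp add: metrized_graph_def)
  have val: "valence \<Gamma> (Node p) =
      card {e \<in> edges \<Gamma>. tail \<Gamma> e = p} + card {e \<in> edges \<Gamma>. head \<Gamma> e = p}" for p
  proof -
    have "directions \<Gamma> (Node p) = (\<lambda>e. (e, True)) ` {e \<in> edges \<Gamma>. tail \<Gamma> e = p} \<union>
        (\<lambda>e. (e, False)) ` {e \<in> edges \<Gamma>. head \<Gamma> e = p}" (is "_ = ?A \<union> ?B")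
      by auto
    moreover have "card (?A \<union> ?B) = card ?A + card ?B"
      using fin by (intro card_Un_disjoint) auto
    ultimately show ?thesis by (simp add: valence_def card_image inj_on_def)
  qed
  have fib: "(\<Sum>p\<in>UNIV. card {e \<in> edges \<Gamma>. h e = p}) = card (edges \<Gamma>)" for h :: "'e \<Rightarrow> 'v"
    using sum.group[OF fin finite, of h UNIV "\<lambda>_. 1::nat"] by simp
  have "(\<Sum>p\<in>UNIV. valence \<Gamma> (Node p)) = 2 * card (edges \<Gamma>)"
    by (simp add: val sum.distrib fib)
  then have "(\<Sum>p\<in>UNIV. real (valence \<Gamma> (Node p))) = 2 * real (card (edges \<Gamma>))"
    by (metis of_nat_sum of_nat_mult of_nat_numeral)
  then show ?thesis
    by (simp add: pm_genus_def canonical_coeff_def vertex_set_def sum.reindex inj_on_def card_image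
        sum.distrib sum_subtractf sum_distrib_left[symmetric] field_simps)
qed

definition theta :: "('v::finite, 'e) mgraph \<Rightarrow> (('v, 'e) point \<Rightarrow> nat) \<Rightarrow> real" where
  "theta \<Gamma> Q = (\<Sum>x\<in>vertex_set \<Gamma>. \<Sum>y\<in>vertex_set \<Gamma>.
     (real (valence \<Gamma> x) - 2 + 2 * real (Q x)) * (real (valence \<Gamma> y) - 2 + 2 * real (Q y)) *
     resistance \<Gamma> x y)"

section \<open>Discrete Laplacian and Moore--Penrose inverse\<close>

definition edges_between :: "('v::finite, 'e) mgraph \<Rightarrow> 'v \<Rightarrow> 'v \<Rightarrow> 'e set" where
  "edges_between \<Gamma> p q = {e \<in> edges \<Gamma>. {tail \<Gamma> e, head \<Gamma> e} = {p, q}}"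

text \<open>
  The off-diagonal entries; for an adequate vertex set \<open>edges_between \<Gamma> p q\<close> has at most one element.
\<close>

definition laplacian_off :: "('v::finite, 'e) mgraph \<Rightarrow> 'v \<Rightarrow> 'v \<Rightarrow> real" where
  "laplacian_off \<Gamma> p q =
     (if edges_between \<Gamma> p q = {} then 0 else - 1 / len \<Gamma> (the_elem (edges_between \<Gamma> p q)))"

definition laplacian :: "('v::finite, 'e) mgraph \<Rightarrow> real ^ 'v ^ 'v" where
  "laplacian \<Gamma> = (\<chi> p q. if p = q then - (\<Sum>s\<in>UNIV - {p}. laplacian_off \<Gamma> p s)
                        else laplacian_off \<Gamma> p q)"

definition is_pseudo_inverse :: "real ^ 'n ^ 'm \<Rightarrow> real ^ 'm ^ 'n \<Rightarrow> bool" where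
  "is_pseudo_inverse A X \<longleftrightarrow>
     A ** X ** A = A \<and> X ** A ** X = X \<and>
     transpose (A ** X) = A ** X \<and> transpose (X ** A) = X ** A"

definition pseudo_inverse :: "real ^ 'n ^ 'm \<Rightarrow> real ^ 'm ^ 'n" where
  "pseudo_inverse A = (THE X. is_pseudo_inverse A X)"

end

theory Submission
  imports Defs
begin

text \<open>
  Restricted to the vertices, a potential for a unit current from \<open>x\<close> to \<open>y\<close> is a solution of
  \<open>L v = \<delta>\<^sub>x - \<delta>\<^sub>y\<close>, so it is \<open>L\<^sup>+ (\<delta>\<^sub>x - \<delta>\<^sub>y)\<close> up to a constant and
  \<open>r(x, y) = l\<^sup>+\<^sub>x\<^sub>x - 2 l\<^sup>+\<^sub>x\<^sub>y + l\<^sup>+\<^sub>y\<^sub>y\<close>. Summing against the canonical coefficients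
  gives the formula, because the rows of \<open>L\<^sup>+\<close> sum to zero, so that adding 2 to the coefficients
  does not change the quadratic form. With \<open>P\<close> the averaging projection, \<open>L + P\<close> is invertible and
  \<open>L\<^sup>+ = (L + P)\<^sup>-\<^sup>1 - P\<close>.
\<close>

section \<open>Pseudo inverses\<close>

text \<open>Both \<open>A ** X\<close> and \<open>A ** Y\<close> are symmetric idempotents with the
  range of \<open>A\<close>, so they are the same orthogonal projection; \<open>X ** A\<close> and
  \<open>Y ** A\<close> agree similarly. The middle condition then gives X = XAX = YAY = Y.\<close>

lemma is_pseudo_inverse_unique:
  assumes X: "is_pseudo_inverse A X" and Y: "is_pseudo_inverse A Y"
  shows "X = Y"
proof -
  have AX: "A ** X = A ** Y"
  proof -
    have "A ** X = transpose (A ** X)" using X by (simp add: is_pseudo_inverse_def)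
    also have "\<dots> = transpose ((A ** Y) ** (A ** X))"
      using Y by (simp add: is_pseudo_inverse_def matrix_mul_assoc)
    also have "\<dots> = (A ** X) ** (A ** Y)"
      using X Y by (simp add: is_pseudo_inverse_def matrix_transpose_mul)
    also have "\<dots> = A ** Y"
      using X by (simp add: is_pseudo_inverse_def matrix_mul_assoc)
    finally show ?thesis .
  qed
  have XA: "X ** A = Y ** A"
  proof -
    have "X ** A = transpose (X ** A)" using X by (simp add: is_pseudo_inverse_def)
    also have "\<dots> = transpose ((X ** A) ** (Y ** A))"
      using Y by (simp add: is_pseudo_inverse_def flip: matrix_mul_assoc)
    also have "\<dots> = (Y ** A) ** (X ** A)"
      using X Y by (simp only: is_pseudo_inverse_def matrix_transpose_mul)
    also have "\<dots> = Y ** A"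
      using X by (simp add: is_pseudo_inverse_def flip: matrix_mul_assoc)
    finally show ?thesis .
  qed
  have "X = X ** (A ** X)" using X by (simp add: is_pseudo_inverse_def matrix_mul_assoc)
  also have "\<dots> = (Y ** A) ** Y" by (simp add: AX XA matrix_mul_assoc)
  also have "\<dots> = Y" using Y by (simp add: is_pseudo_inverse_def)
  finally show ?thesis .
qed

lemma pseudo_inverse_eqI: "is_pseudo_inverse A X \<Longrightarrow> pseudo_inverse A = X"
  unfolding pseudo_inverse_def by (blast intro: the_equality is_pseudo_inverse_unique)

lemma symmetric_entry: "transpose A = A \<Longrightarrow> A $ i $ j = A $ j $ i"
  by (metis transpose_def vec_lambda_beta)

lemma transpose_add: "transpose (A + B) = transpose A + transpose B"
  by (simp add: transpose_def vec_eq_iff)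

lemma transpose_diff: "transpose (A - B) = transpose A - transpose B"
  by (simp add: transpose_def vec_eq_iff)

lemma matrix_add_rdistrib: "(A + B) ** C = A ** C + B ** C"
  by (vector matrix_matrix_mult_def sum.distrib[symmetric] distrib_right)

lemma matrix_diff_ldistrib: "A ** (B - C) = A ** B - A ** C"
  for A :: "'a::ring_1 ^ 'n ^ 'm"
  by (vector matrix_matrix_mult_def sum_subtractf[symmetric] right_diff_distrib)

lemma matrix_diff_rdistrib: "(A - B) ** C = A ** C - B ** C"
  for A :: "'a::ring_1 ^ 'n ^ 'm"
  by (vector matrix_matrix_mult_def sum_subtractf[symmetric] left_diff_distrib)

section \<open>The averaging projection and symmetric matrices whose kernel is the constants\<close>

definition averaging :: "real ^ 'n ^ 'n" where
  "averaging = (\<chi> i j. 1 / real CARD('n))"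

lemma averaging_mult_vec: "(averaging *v x) $ i = (\<Sum>j\<in>UNIV. x $ j) / real CARD('n)"
  for x :: "real ^ 'n"
  by (simp add: averaging_def matrix_vector_mult_def sum_divide_distrib)

lemma transpose_averaging: "transpose averaging = averaging"
  by (simp add: averaging_def transpose_def)

lemma averaging_idem: "averaging ** averaging = averaging"
  by (simp add: averaging_def matrix_matrix_mult_def)

lemma averaging_mult_eq_0_iff:
  "averaging ** A = 0 \<longleftrightarrow> (\<forall>j. (\<Sum>i\<in>UNIV. A $ i $ j) = 0)" for A :: "real ^ 'm ^ 'n"
  by (auto simp: averaging_def matrix_matrix_mult_def vec_eq_iff simp flip: sum_divide_distrib)

text \<open>The hypotheses say that the kernel of \<open>A\<close> is exactly the constant vectors
  and its range exactly their orthogonal complement. Hence both products with the pseudo inverse are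
  the projection onto the vectors of sum zero.\<close>

lemma symmetric_pseudo_inverse:
  fixes A :: "real ^ 'n ^ 'n"
  assumes sym: "transpose A = A" and PA: "averaging ** A = 0"
    and ker: "\<And>x. A *v x = 0 \<Longrightarrow> \<exists>c. \<forall>i. x $ i = c"
  defines "X \<equiv> pseudo_inverse A"
  shows "A ** X = mat 1 - averaging" "X ** A = mat 1 - averaging"
    "transpose X = X" "averaging ** X = 0"
proof -
  define P :: "real ^ 'n ^ 'n" where "P = averaging"
  have PP: "P ** P = P" and tP: "transpose P = P" and PA: "P ** A = 0"
    using PA by (simp_all add: P_def averaging_idem transpose_averaging)
  have AP: "A ** P = 0"
  proof -
    have "A ** P = transpose (P ** A)" by (simp add: matrix_transpose_mul sym tP)
    then show ?thesis by (simp add: PA transpose_def vec_eq_iff)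
  qed
  define M where "M = A + P"
  have "x = 0" if "M *v x = 0" for x
  proof -
    \<comment> \<open>Applying \<open>P\<close> kills the contribution of \<open>A\<close> and
      isolates \<open>P *v x\<close>; a constant vector with zero average is zero.\<close>
    have "P *v (M *v x) = P *v x"
      by (simp add: M_def matrix_vector_mul_assoc matrix_add_ldistrib PA PP)
    then have Px: "P *v x = 0" using that by simp
    then have "A *v x = 0" using that by (simp add: M_def matrix_vector_mult_add_rdistrib)
    then obtain c where c: "\<And>i. x $ i = c" using ker by blast
    have "(P *v x) $ i = c" for i by (simp add: P_def averaging_mult_vec c)
    then show "x = 0" using Px c by (simp add: vec_eq_iff)
  qed
  then obtain N where NM: "N ** M = mat 1"
    using matrix_left_invertible_ker by blast
  then have MN: "M ** N = mat 1" by (simp add: matrix_left_right_inverse)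
  have MP: "M ** P = P" by (simp add: M_def matrix_add_rdistrib AP PP)
  have PM: "P ** M = P" by (simp add: M_def matrix_add_ldistrib PA PP)
  have NP: "N ** P = P" by (metis MP NM matrix_mul_assoc matrix_mul_lid)
  have PN: "P ** N = P" by (metis PM MN matrix_mul_assoc matrix_mul_rid)
  have tM: "transpose M = M" by (simp add: M_def sym tP transpose_add)
  have tN: "transpose N = N"
  proof -
    have "transpose N = (transpose N ** M) ** N" by (simp add: MN flip: matrix_mul_assoc)
    also have "transpose N ** M = transpose (M ** N)" by (simp add: matrix_transpose_mul tM)
    finally show ?thesis by (simp add: MN)
  qed
  \<comment> \<open>\<open>N\<close> acts as the identity on constants; subtracting \<open>P\<close>
    makes them vanish and changes nothing on vectors of sum zero.\<close>
  define Y where "Y = N - P"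
  have AM: "A = M - P" by (simp add: M_def)
  have AY: "A ** Y = mat 1 - P" and YA: "Y ** A = mat 1 - P"
    by (simp_all add: AM Y_def matrix_diff_ldistrib matrix_diff_rdistrib MN NM MP PM NP PN PP)
  have tY: "transpose Y = Y"
    by (simp add: Y_def transpose_diff tN tP)
  have PY: "P ** Y = 0" by (simp add: Y_def matrix_diff_ldistrib PN PP)
  have tD: "transpose (mat 1 - P) = mat 1 - P"
    by (simp add: transpose_diff transpose_mat tP)
  \<comment> \<open>With both products equal to 1 - P, the first two Penrose conditions reduce to PA
    = 0 and PY = 0.\<close>
  have "is_pseudo_inverse A Y"
    by (simp add: is_pseudo_inverse_def AY YA tD matrix_diff_rdistrib PA PY)
  then have "X = Y" by (simp add: X_def pseudo_inverse_eqI)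
  then show "A ** X = mat 1 - averaging" "X ** A = mat 1 - averaging"
    "transpose X = X" "averaging ** X = 0"
    using AY YA tY PY by (simp_all add: P_def)
qed

section \<open>The Laplacian as a sum over directions\<close>

definition endpoint :: "('v::finite, 'e) mgraph \<Rightarrow> 'e \<times> bool \<Rightarrow> 'v" where
  "endpoint \<Gamma> d = (if snd d then head \<Gamma> (fst d) else tail \<Gamma> (fst d))"

lemma finite_directions_Node: "metrized_graph \<Gamma> \<Longrightarrow> finite (directions \<Gamma> (Node p))"
  by (rule finite_subset[of _ "edges \<Gamma> \<times> UNIV"]) (auto simp: metrized_graph_def)

text \<open>Adequacy leaves at most one edge between two vertices, so \<open>the_elem\<close> picks
  it out; the empty sum covers non-adjacent vertices.\<close>

lemma laplacian_off_eq:
  assumes "adequate \<Gamma>"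
  shows "- laplacian_off \<Gamma> p s = (\<Sum>e\<in>edges_between \<Gamma> p s. 1 / len \<Gamma> e)"
proof (cases "edges_between \<Gamma> p s = {}")
  case False
  then obtain e where "e \<in> edges_between \<Gamma> p s" by blast
  then have "edges_between \<Gamma> p s = {e}"
    using assms unfolding adequate_def edges_between_def
    by (intro set_eqI) (metis (mono_tags, lifting) mem_Collect_eq singleton_iff)
  then show ?thesis by (simp add: laplacian_off_def)
qed (simp add: laplacian_off_def)

text \<open>Grouping directions by their far end turns a matrix row into a sum of differences over
  lengths, which is the shape of Kirchhoff's law.\<close>

lemma laplacian_mult_vec:
  fixes \<Gamma> :: "('v::finite, 'e) mgraph"
  assumes "metrized_graph \<Gamma>" and ad: "adequate \<Gamma>"
  shows "(laplacian \<Gamma> *v x) $ p =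
    (\<Sum>d\<in>directions \<Gamma> (Node p). (x $ p - x $ endpoint \<Gamma> d) / len \<Gamma> (fst d))"
    (is "_ = sum ?h ?D")
proof -
  have noloop: "tail \<Gamma> e \<noteq> head \<Gamma> e" if "e \<in> edges \<Gamma>" for e
    using ad that by (simp add: adequate_def)
  \<comment> \<open>Without self-loops, an edge between \<open>p\<close> and another vertex
    \<open>s\<close> supplies exactly one direction at \<open>p\<close>.\<close>
  have bij: "bij_betw fst {d \<in> ?D. endpoint \<Gamma> d = s} (edges_between \<Gamma> p s)" if "s \<noteq> p" for s
    using that
    by (auto simp: bij_betw_def inj_on_def edges_between_def endpoint_def image_iff doubleton_eq_iff
        dest: noloop)
  have "(laplacian \<Gamma> *v x) $ p =
      laplacian \<Gamma> $ p $ p * x $ p + (\<Sum>s\<in>UNIV - {p}. laplacian \<Gamma> $ p $ s * x $ s)"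
    by (simp add: matrix_vector_mult_def sum.remove[of UNIV p])
  also have "\<dots> = (\<Sum>s\<in>UNIV - {p}. - laplacian_off \<Gamma> p s * (x $ p - x $ s))"
    by (simp add: laplacian_def right_diff_distrib sum_negf sum_subtractf sum_distrib_right)
  also have "\<dots> = (\<Sum>s\<in>UNIV - {p}. \<Sum>d\<in>{d \<in> ?D. endpoint \<Gamma> d = s}. ?h d)"
  proof (rule sum.cong)
    fix s assume "s \<in> UNIV - {p}"
    then have "(\<Sum>d\<in>{d \<in> ?D. endpoint \<Gamma> d = s}. (x $ p - x $ s) / len \<Gamma> (fst d)) =
        (\<Sum>e\<in>edges_between \<Gamma> p s. (x $ p - x $ s) / len \<Gamma> e)"
      by (intro sum.reindex_bij_betw bij) simp
    then show "- laplacian_off \<Gamma> p s * (x $ p - x $ s) = (\<Sum>d\<in>{d \<in> ?D. endpoint \<Gamma> d = s}. ?h d)"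
      by (simp add: laplacian_off_eq[OF ad] sum_distrib_right)
  qed simp
  also have "\<dots> = sum ?h ?D"
  proof -
    have "endpoint \<Gamma> d \<noteq> p" if "d \<in> ?D" for d
      using that noloop[of "fst d"] by (auto simp: endpoint_def)
    then have "endpoint \<Gamma> ` ?D \<subseteq> UNIV - {p}" by blast
    from sum.group[OF finite_directions_Node[OF assms(1)] finite this, of ?h] show ?thesis .
  qed
  finally show ?thesis .
qed

lemma transpose_laplacian: "transpose (laplacian \<Gamma>) = laplacian \<Gamma>"
proof -
  have "edges_between \<Gamma> p q = edges_between \<Gamma> q p" for p q
    by (simp only: edges_between_def insert_commute[of p q])
  then have "laplacian_off \<Gamma> p q = laplacian_off \<Gamma> q p" for p q
    by (metis laplacian_off_def)
  then show ?thesis by (simp add: transpose_def laplacian_def vec_eq_iff)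
qed

lemma averaging_laplacian: "averaging ** laplacian \<Gamma> = 0"
proof -
  have "(\<Sum>i\<in>UNIV. laplacian \<Gamma> $ i $ j) = 0" for j
  proof -
    have "(\<Sum>i\<in>UNIV. laplacian \<Gamma> $ i $ j) = (\<Sum>i\<in>UNIV. laplacian \<Gamma> $ j $ i)"
      by (intro sum.cong refl symmetric_entry transpose_laplacian)
    also have "\<dots> = 0" by (simp add: laplacian_def sum.remove[of UNIV j])
    finally show ?thesis .
  qed
  then show ?thesis by (simp add: averaging_mult_eq_0_iff)
qed

text \<open>
  Maximum principle: where a harmonic vector attains its maximum, so do all the neighbours.
\<close>

lemma laplacian_kernel:
  fixes \<Gamma> :: "('v::finite, 'e) mgraph"
  assumes mg: "metrized_graph \<Gamma>" and ad: "adequate \<Gamma>" and Lx: "laplacian \<Gamma> *v x = 0"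
  shows "\<exists>c. \<forall>i. x $ i = c"
proof -
  define m where "m = Max (range (\<lambda>i. x $ i))"
  have le: "x $ i \<le> m" for i by (simp add: m_def)
  have "m \<in> range (\<lambda>i. x $ i)" unfolding m_def by (intro Max_in) auto
  then obtain p where p: "x $ p = m" by auto
  have nbr: "x $ endpoint \<Gamma> d = m" if "x $ q = m" "d \<in> directions \<Gamma> (Node q)" for q d
  proof -
    have pos: "len \<Gamma> (fst d') > 0" if "d' \<in> directions \<Gamma> (Node q)" for d'
      using mg that by (auto simp: metrized_graph_def)
    \<comment> \<open>At a maximum no summand is negative, so a vanishing sum makes every summand
      vanish.\<close>
    have "(\<Sum>d\<in>directions \<Gamma> (Node q). (m - x $ endpoint \<Gamma> d) / len \<Gamma> (fst d)) = 0"
      using laplacian_mult_vec[OF mg ad, of x q] Lx that by simp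
    then have "(m - x $ endpoint \<Gamma> d) / len \<Gamma> (fst d) = 0"
      using pos le that
      by (subst (asm) sum_nonneg_eq_0_iff)
        (auto simp: finite_directions_Node[OF mg] less_imp_le simp del: directions.simps)
    then show ?thesis using pos[OF that(2)] by simp
  qed
  have "x $ q = m" for q
  proof -
    \<comment> \<open>Connectedness gives a path from the maximum point \<open>p\<close> to
      \<open>q\<close>, along which the value propagates by induction.\<close>
    have "(p, q) \<in> ({(tail \<Gamma> e, head \<Gamma> e) | e. e \<in> edges \<Gamma>} \<union>
        {(head \<Gamma> e, tail \<Gamma> e) | e. e \<in> edges \<Gamma>})\<^sup>*"
      using mg by (simp add: metrized_graph_def)
    then show ?thesis
    proof induction
      case (step q r)
      then obtain e where "e \<in> edges \<Gamma>"
        and "tail \<Gamma> e = q \<and> head \<Gamma> e = r \<or> head \<Gamma> e = q \<and> tail \<Gamma> e = r" by blast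
      then show ?case
        using nbr[OF step.IH, of "(e, True)"] nbr[OF step.IH, of "(e, False)"]
        by (auto simp: endpoint_def)
    qed (rule p)
  qed
  then show ?thesis by blast
qed

section \<open>Effective resistance between vertices\<close>

lemma outflow_eqI:
  assumes "0 < \<epsilon>" and "\<And>s. 0 < s \<Longrightarrow> s < \<epsilon> \<Longrightarrow> f z - f (move \<Gamma> z d s) = k * s"
  shows "outflow \<Gamma> f z d = k"
proof -
  have "eventually (\<lambda>s. (f z - f (move \<Gamma> z d s)) / s = k) (at_right 0)"
    unfolding eventually_at_right_field using assms by (intro exI[of _ \<epsilon>]) auto
  then show ?thesis
    unfolding outflow_def by (intro tendsto_Lim tendsto_eventually) simp_all
qed

text \<open>Ohm's law on whole closed edges. Since \<open>along\<close> yields the vertices at both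
  ends, agreement with the vertex values is included.\<close>

definition edgewise_affine :: "('v::finite, 'e) mgraph \<Rightarrow> (('v, 'e) point \<Rightarrow> real) \<Rightarrow> bool" where
  "edgewise_affine \<Gamma> f \<longleftrightarrow> (\<forall>e\<in>edges \<Gamma>. \<exists>c. \<forall>s\<in>{0..len \<Gamma> e}. \<forall>t\<in>{0..len \<Gamma> e}.
     f (along \<Gamma> e s) - f (along \<Gamma> e t) = c * (t - s))"

text \<open>An affine function has the same slope over a short initial piece as over the whole edge,
  so the limit becomes a difference quotient of vertex values.\<close>

lemma outflow_Node:
  assumes mg: "metrized_graph \<Gamma>" and aff: "edgewise_affine \<Gamma> f"
    and d: "d \<in> directions \<Gamma> (Node p)"
  shows "outflow \<Gamma> f (Node p) d = (f (Node p) - f (Node (endpoint \<Gamma> d))) / len \<Gamma> (fst d)"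
proof -
  obtain e b where deb: "d = (e, b)" by (cases d)
  then have e: "e \<in> edges \<Gamma>" using d by auto
  then have l: "len \<Gamma> e > 0" using mg by (simp add: metrized_graph_def)
  obtain c where c: "\<And>s t. s \<in> {0..len \<Gamma> e} \<Longrightarrow> t \<in> {0..len \<Gamma> e} \<Longrightarrow>
      f (along \<Gamma> e s) - f (along \<Gamma> e t) = c * (t - s)"
    using aff e unfolding edgewise_affine_def by meson
  have ends: "along \<Gamma> e 0 = Node (tail \<Gamma> e)" "along \<Gamma> e (len \<Gamma> e) = Node (head \<Gamma> e)"
    using l by (simp_all add: along_def)
  have drop: "f (Node (tail \<Gamma> e)) - f (Node (head \<Gamma> e)) = c * len \<Gamma> e"
    using c[of 0 "len \<Gamma> e"] l by (simp add: ends)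
  show ?thesis
  proof (cases b)
    case True
    then have "tail \<Gamma> e = p" using d deb by auto
    moreover have "outflow \<Gamma> f (Node p) d = c"
      using c[of 0] l calculation True deb by (intro outflow_eqI[of "len \<Gamma> e"]) (auto simp: ends)
    ultimately show ?thesis using drop l True deb by (simp add: endpoint_def)
  next
    case False
    then have "head \<Gamma> e = p" using d deb by auto
    \<comment> \<open>The current \<open>c\<close> is counted from tail to head, but this direction
      leaves the head.\<close>
    moreover have "outflow \<Gamma> f (Node p) d = - c"
      using c[of "len \<Gamma> e"] l calculation False deb
      by (intro outflow_eqI[of "len \<Gamma> e"]) (auto simp: ends)
    ultimately show ?thesis using drop l False deb by (simp add: endpoint_def field_simps)
  qed
qed

text \<open>The two directions carry opposite currents, so Kirchhoff's law at points inside edges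
  follows from affinity alone.\<close>

lemma sum_outflow_Inner:
  assumes aff: "edgewise_affine \<Gamma> f" and e: "e \<in> edges \<Gamma>" and t: "0 < t" "t < len \<Gamma> e"
  shows "(\<Sum>d\<in>directions \<Gamma> (Inner e t). outflow \<Gamma> f (Inner e t) d) = 0"
proof -
  obtain c where c: "\<And>s t. s \<in> {0..len \<Gamma> e} \<Longrightarrow> t \<in> {0..len \<Gamma> e} \<Longrightarrow>
      f (along \<Gamma> e s) - f (along \<Gamma> e t) = c * (t - s)"
    using aff e unfolding edgewise_affine_def by meson
  have "along \<Gamma> e t = Inner e t" using t by (simp add: along_def)
  then have "outflow \<Gamma> f (Inner e t) (e, True) = c" "outflow \<Gamma> f (Inner e t) (e, False) = - c"
    using c[of t] t
    by - (rule outflow_eqI[of "len \<Gamma> e - t"], simp_all, rule outflow_eqI[of t], simp_all)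
  then show ?thesis by simp
qed

text \<open>This reduces the circuit to linear algebra: Ohm's law determines the potential along
  edges from its vertex values, and Kirchhoff's law at the vertices is a Laplace equation.\<close>

lemma circuit_potential_Node_iff:
  fixes \<Gamma> :: "('v::finite, 'e) mgraph"
  assumes mg: "metrized_graph \<Gamma>" and ad: "adequate \<Gamma>"
  shows "circuit_potential \<Gamma> (Node p) (Node q) f \<longleftrightarrow>
    edgewise_affine \<Gamma> f \<and> laplacian \<Gamma> *v (\<chi> i. f (Node i)) = axis p 1 - axis q 1"
proof -
  have pos: "0 < len \<Gamma> e" if "e \<in> edges \<Gamma>" for e using mg that by (simp add: metrized_graph_def)
  \<comment> \<open>Source and sink are vertices, so no open edge meets them and Ohm's law may be
    used with a = 0 and b the full length.\<close>
  have inner: "along \<Gamma> e t \<notin> {Node p, Node q}" if "0 < t" "t < len \<Gamma> e" for e t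
    using that by (simp add: along_def)
  have ohm: "(\<forall>e\<in>edges \<Gamma>. \<forall>a b. 0 \<le> a \<and> a < b \<and> b \<le> len \<Gamma> e \<and>
        (\<forall>t\<in>{a<..<b}. along \<Gamma> e t \<notin> {Node p, Node q}) \<longrightarrow>
        (\<exists>c. \<forall>s\<in>{a..b}. \<forall>t\<in>{a..b}. f (along \<Gamma> e s) - f (along \<Gamma> e t) = c * (t - s))) \<longleftrightarrow>
      edgewise_affine \<Gamma> f" (is "?ohm \<longleftrightarrow> _")
  proof
    assume ?ohm
    then show "edgewise_affine \<Gamma> f"
      unfolding edgewise_affine_def using pos inner by (metis greaterThanLessThan_iff order_refl)
  next
    assume aff: "edgewise_affine \<Gamma> f"
    show ?ohm
    proof (intro ballI allI impI)
      fix e a b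
      assume "e \<in> edges \<Gamma>" and ab: "0 \<le> a \<and> a < b \<and> b \<le> len \<Gamma> e \<and>
        (\<forall>t\<in>{a<..<b}. along \<Gamma> e t \<notin> {Node p, Node q})"
      then obtain c where "\<forall>s\<in>{0..len \<Gamma> e}. \<forall>t\<in>{0..len \<Gamma> e}.
          f (along \<Gamma> e s) - f (along \<Gamma> e t) = c * (t - s)"
        using aff unfolding edgewise_affine_def by blast
      then show "\<exists>c. \<forall>s\<in>{a..b}. \<forall>t\<in>{a..b}. f (along \<Gamma> e s) - f (along \<Gamma> e t) = c * (t - s)"
        using ab by (intro exI[of _ c]) auto
    qed
  qed
  have kirchhoff: "(\<forall>z\<in>points \<Gamma>. (\<Sum>d\<in>directions \<Gamma> z. outflow \<Gamma> f z d) =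
        (if z = Node p then 1 else 0) - (if z = Node q then 1 else 0)) \<longleftrightarrow>
      laplacian \<Gamma> *v (\<chi> i. f (Node i)) = axis p 1 - axis q 1" (is "?kir \<longleftrightarrow> ?lap")
    if aff: "edgewise_affine \<Gamma> f"
  proof -
    have node: "(\<Sum>d\<in>directions \<Gamma> (Node i). outflow \<Gamma> f (Node i) d) =
        (laplacian \<Gamma> *v (\<chi> i. f (Node i))) $ i" for i
      unfolding laplacian_mult_vec[OF mg ad]
      by (rule sum.cong) (simp_all only: outflow_Node[OF mg aff] vec_lambda_beta)
    have "?kir \<longleftrightarrow> (\<forall>i. (\<Sum>d\<in>directions \<Gamma> (Node i). outflow \<Gamma> f (Node i) d) =
        (if i = p then 1 else 0) - (if i = q then 1 else 0))"
      using sum_outflow_Inner[OF aff]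
      by (auto simp: points_def vertex_set_def simp del: directions.simps)
    also have "\<dots> \<longleftrightarrow> ?lap"
      unfolding node by (simp add: vec_eq_iff axis_def)
    finally show ?thesis .
  qed
  show ?thesis unfolding circuit_potential_def ohm using kirchhoff by blast
qed

text \<open>Linear interpolation along each edge; this turns vectors solving the Laplace equation
  into actual potentials.\<close>

lemma edgewise_affine_extension:
  assumes mg: "metrized_graph \<Gamma>"
  obtains f where "edgewise_affine \<Gamma> f" "\<And>i. f (Node i) = v i"
proof
  let ?f = "\<lambda>z. case z of Node i \<Rightarrow> v i
    | Inner e t \<Rightarrow> v (tail \<Gamma> e) + (v (head \<Gamma> e) - v (tail \<Gamma> e)) * t / len \<Gamma> e"
  show "edgewise_affine \<Gamma> ?f"
    unfolding edgewise_affine_def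
  proof
    fix e assume "e \<in> edges \<Gamma>"
    then have l: "len \<Gamma> e > 0" using mg by (simp add: metrized_graph_def)
    \<comment> \<open>At the two ends the interpolation formula returns the vertex values, so one
      formula covers all cases of \<open>along\<close>.\<close>
    have "?f (along \<Gamma> e t) = v (tail \<Gamma> e) + (v (head \<Gamma> e) - v (tail \<Gamma> e)) * t / len \<Gamma> e" for t
      using l by (simp add: along_def)
    then show "\<exists>c. \<forall>s\<in>{0..len \<Gamma> e}. \<forall>t\<in>{0..len \<Gamma> e}.
        ?f (along \<Gamma> e s) - ?f (along \<Gamma> e t) = c * (t - s)"
      using l by (intro exI[of _ "(v (tail \<Gamma> e) - v (head \<Gamma> e)) / len \<Gamma> e"]) (simp add: field_simps)
  qed
qed simp

text \<open>The description by \<open>THE\<close> requires a potential to exist and its drop to be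
  unique. \<open>X *v b\<close> provides the former, and any other solution differs from it by a
  constant on the vertices.\<close>

lemma resistance_Node:
  fixes \<Gamma> :: "('v::finite, 'e) mgraph"
  assumes mg: "metrized_graph \<Gamma>" and ad: "adequate \<Gamma>"
  defines "X \<equiv> pseudo_inverse (laplacian \<Gamma>)"
  shows "resistance \<Gamma> (Node p) (Node q) = X $ p $ p - 2 * X $ p $ q + X $ q $ q"
proof -
  note LX = symmetric_pseudo_inverse[OF transpose_laplacian[of \<Gamma>] averaging_laplacian
      laplacian_kernel[OF mg ad], folded X_def]
  have sym: "X $ q $ p = X $ p $ q"
    by (rule symmetric_entry[OF LX(3)])
  define b :: "real ^ 'v" where "b = axis p 1 - axis q 1"
  have Xb: "(X *v b) $ i = X $ i $ p - X $ i $ q" for i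
    by (simp add: b_def matrix_vector_mult_diff_distrib matrix_vector_mult_basis column_def)
  \<comment> \<open>The injected current has total zero, so the projection
    \<open>laplacian \<Gamma> ** X\<close> fixes \<open>b\<close> and the equation is
    solvable.\<close>
  have "averaging *v b = 0"
    by (simp add: vec_eq_iff averaging_mult_vec b_def sum_subtractf axis_def)
  then have "laplacian \<Gamma> *v (X *v b) = b"
    by (simp add: matrix_vector_mul_assoc LX matrix_vector_mult_diff_rdistrib)
  moreover obtain f where "edgewise_affine \<Gamma> f" "\<And>i. f (Node i) = (X *v b) $ i"
    using edgewise_affine_extension[OF mg] by blast
  ultimately have ex: "circuit_potential \<Gamma> (Node p) (Node q) f"
    by (simp add: circuit_potential_Node_iff[OF mg ad] b_def)
  have uniq: "f (Node p) - f (Node q) = X $ p $ p - 2 * X $ p $ q + X $ q $ q"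
    if "circuit_potential \<Gamma> (Node p) (Node q) f" for f
  proof -
    define v :: "real ^ 'v" where "v = (\<chi> i. f (Node i))"
    have "laplacian \<Gamma> *v v = b"
      using that by (simp add: circuit_potential_Node_iff[OF mg ad] b_def v_def)
    \<comment> \<open>The averaging term is a constant vector and cancels in the drop between
      \<open>p\<close> and \<open>q\<close>.\<close>
    then have "X *v b = v - averaging *v v"
      by (metis LX(2) matrix_vector_mul_assoc matrix_vector_mult_diff_rdistrib matrix_vector_mul_lid)
    then have "v $ p - v $ q = (X *v b) $ p - (X *v b) $ q"
      by (simp add: averaging_mult_vec)
    then show ?thesis by (simp add: Xb sym v_def)
  qed
  show ?thesis
    unfolding resistance_def by (rule the_equality) (use ex uniq in metis)+
qed

section \<open>Summation of the resistances against the canonical divisor\<close>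

theorem theorem3p6:
  fixes \<Gamma> :: "('v::finite, 'e) mgraph" and Q :: "('v, 'e) point \<Rightarrow> nat"
  assumes "pm_graph \<Gamma> Q" and "adequate \<Gamma>"
  shows "theta \<Gamma> Q =
    2 * (2 * pm_genus \<Gamma> Q - 2) *
      (\<Sum>p\<in>UNIV. (real (valence \<Gamma> (Node p)) - 2 + 2 * real (Q (Node p))) *
        pseudo_inverse (laplacian \<Gamma>) $ p $ p)
    - 2 * (\<Sum>p\<in>UNIV. \<Sum>q\<in>UNIV. (real (valence \<Gamma> (Node p)) + 2 * real (Q (Node p))) *
        (real (valence \<Gamma> (Node q)) + 2 * real (Q (Node q))) *
        pseudo_inverse (laplacian \<Gamma>) $ p $ q)"
proof -
  have mg: "metrized_graph \<Gamma>" using assms by (simp add: pm_graph_def)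
  define X where "X = pseudo_inverse (laplacian \<Gamma>)"
  define k where "k = (\<lambda>p. real (valence \<Gamma> (Node p)) - 2 + 2 * real (Q (Node p)))"
  note LX = symmetric_pseudo_inverse[OF transpose_laplacian[of \<Gamma>] averaging_laplacian
      laplacian_kernel[OF mg assms(2)], folded X_def]
  have col: "(\<Sum>i\<in>UNIV. X $ i $ j) = 0" for j
    using LX(4) by (simp add: averaging_mult_eq_0_iff)
  have "X $ j $ i = X $ i $ j" for i j
    by (rule symmetric_entry[OF LX(3)])
  then have row: "(\<Sum>j\<in>UNIV. X $ i $ j) = 0" for i
    using col[of i] by simp
  \<comment> \<open>Both sides are the degree of the canonical divisor.\<close>
  have deg: "2 * pm_genus \<Gamma> Q - 2 = (\<Sum>p\<in>UNIV. k p)"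
    by (simp add: pm_genus_def canonical_coeff_def vertex_set_def sum.reindex inj_on_def k_def)
  have diag: "(\<Sum>p\<in>UNIV. \<Sum>q\<in>UNIV. k p * k q * X $ p $ p) =
      sum k UNIV * (\<Sum>p\<in>UNIV. k p * X $ p $ p)"
    by (subst sum.swap) (simp add: sum_product mult_ac)
  have diag': "(\<Sum>p\<in>UNIV. \<Sum>q\<in>UNIV. k p * k q * X $ q $ q) =
      sum k UNIV * (\<Sum>p\<in>UNIV. k p * X $ p $ p)"
    by (simp add: sum_product mult_ac)
  have shift: "(\<Sum>p\<in>UNIV. \<Sum>q\<in>UNIV. (k p + 2) * (k q + 2) * X $ p $ q) =
      (\<Sum>p\<in>UNIV. \<Sum>q\<in>UNIV. k p * k q * X $ p $ q)"
  proof -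
    \<comment> \<open>The excess of the product over \<open>k p * k q\<close> is split as 2(k p +
      2), which depends on \<open>p\<close> only, plus 2 k q, which depends on \<open>q\<close>
      only; a row sum kills the first and a column sum the second.\<close>
    have "(\<Sum>p\<in>UNIV. \<Sum>q\<in>UNIV. (k p + 2) * (k q + 2) * X $ p $ q) =
        (\<Sum>p\<in>UNIV. \<Sum>q\<in>UNIV. k p * k q * X $ p $ q)
        + (\<Sum>p\<in>UNIV. 2 * (k p + 2) * (\<Sum>q\<in>UNIV. X $ p $ q))
        + (\<Sum>p\<in>UNIV. \<Sum>q\<in>UNIV. 2 * k q * X $ p $ q)"
      by (simp add: sum_distrib_left sum.distrib algebra_simps)
    also have "(\<Sum>p\<in>UNIV. \<Sum>q\<in>UNIV. 2 * k q * X $ p $ q) =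
        (\<Sum>q\<in>UNIV. 2 * k q * (\<Sum>p\<in>UNIV. X $ p $ q))"
      by (subst sum.swap) (simp add: sum_distrib_left)
    finally show ?thesis by (simp add: row col)
  qed
  have "theta \<Gamma> Q = (\<Sum>p\<in>UNIV. \<Sum>q\<in>UNIV. k p * k q * (X $ p $ p - 2 * X $ p $ q + X $ q $ q))"
    by (simp add: theta_def vertex_set_def sum.reindex inj_on_def k_def X_def
        resistance_Node[OF mg assms(2)])
  also have "\<dots> = (\<Sum>p\<in>UNIV. \<Sum>q\<in>UNIV. k p * k q * X $ p $ p)
      + (\<Sum>p\<in>UNIV. \<Sum>q\<in>UNIV. k p * k q * X $ q $ q)
      - 2 * (\<Sum>p\<in>UNIV. \<Sum>q\<in>UNIV. k p * k q * X $ p $ q)"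
    by (simp add: sum.distrib sum_subtractf sum_distrib_left algebra_simps)
  also have "\<dots> = 2 * (\<Sum>p\<in>UNIV. k p) * (\<Sum>p\<in>UNIV. k p * X $ p $ p)
      - 2 * (\<Sum>p\<in>UNIV. \<Sum>q\<in>UNIV. (k p + 2) * (k q + 2) * X $ p $ q)"
    by (simp add: diag diag' shift)
  finally show ?thesis by (simp add: deg k_def X_def)
qed

end
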